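(* Assume that $\Omega$ is a (non-empty) compact subset of $\mathbb{R}^n$. Suppose that the following modified continuity assumption holds: for any $\varepsilon>0$, there exists $\boldsymbol{x}$ such that, for every $\omega\in\Omega$, there exist $\delta>0$ and $\boldsymbol{y}$ satisfying simultaneously - $A(\omega')\boldsymbol{x}+B(\omega')\boldsymbol{y}\leq\boldsymbol{b}(\omega')$ for all $\omega'\in\Omega$ with $\|\omega-\omega'\|\leq\delta$; - $\boldsymbol{c}^\top\boldsymbol{x}+\boldsymbol{d}^\top\boldsymbol{y}-\varepsilon\leq\operatorname{val}(\mathrm{CompAdapt}(\Omega))$. Then $$\lim_{k\to+\infty}\operatorname{val}(\mathrm{Adapt}_k(\Omega))=\operatorname{val}(\mathrm{CompAdapt}(\Omega)).$$
   Context: $A(\omega)$, $B(\omega)$ are matrices and $\boldsymbol{b}(\omega)$ is a vector, all depending affinely on $\omega\in\Omega$; $\boldsymbol{c}$ and $\boldsymbol{d}$ are fixed vectors. The complete adaptability problem $(\mathrm{CompAdapt}(\Omega))$ is $$\min_{\boldsymbol{x},\boldsymbol{y}(\cdot)}\ \boldsymbol{c}^\top\boldsymbol{x}+\max_{\omega\in\Omega}\boldsymbol{d}^\top\boldsymbol{y}(\omega)\quad\text{s.t.}\quad A(\omega)\boldsymbol{x}+B(\omega)\boldsymbol{y}(\omega)\leq\boldsymbol{b}(\omega)\quad\forall\omega\in\Omega,$$ where $\boldsymbol{y}(\cdot)$ is an arbitrary function of $\omega\in\Omega$. For a positive integer $k$, the finite adaptability problem $(\mathrm{Adapt}_k(\Omega))$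 is $$\min_{\Omega_1,\dots,\Omega_k,\ \boldsymbol{x},\boldsymbol{y}_1,\ldots,\boldsymbol{y}_k}\ \boldsymbol{c}^\top\boldsymbol{x}+\max_{i\in[k]}\boldsymbol{d}^\top\boldsymbol{y}_i\quad\text{s.t.}\quad A(\omega)\boldsymbol{x}+B(\omega)\boldsymbol{y}_i\leq\boldsymbol{b}(\omega)\quad\forall i\in[k]\ \forall\omega\in\Omega_i,$$ where the subsets $\Omega_1,\dots,\Omega_k$ of $\Omega$ are constrained to form a cover of $\Omega$. The vectors $\boldsymbol{x}$, $\boldsymbol{y}(\omega)$, $\boldsymbol{y}_i$ (and the $\boldsymbol{x},\boldsymbol{y}$ of the modified continuity assumption) are real vectors, possibly with prescribed components constrained to be integer, the same in all problems. $\operatorname{val}(P)$ denotes the optimal value of a problem $P$ (minima and maxima being understood as infima and suprema in the extended reals, with value $+\infty$ for an infeasible minimization problem). *)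

theory Defs
  imports "HOL-Analysis.Analysis"
begin

definition affine_on :: "'a::real_vector set \<Rightarrow> ('a \<Rightarrow> 'b::real_vector) \<Rightarrow> bool" where
  "affine_on S f \<longleftrightarrow> (\<exists>L v. linear L \<and> (\<forall>s\<in>S. f s = L s + v))"

definition mixed_integer :: "'i set \<Rightarrow> (real ^ 'i) set" where
  "mixed_integer J = {x. \<forall>j\<in>J. x $ j \<in> \<int>}"

text \<open>
  Throughout, \<open>J\<close> and \<open>K\<close> are the sets of components of the here-and-now and of the recourse
  vectors that are constrained to be integer. The order on \<open>real ^ 'm\<close> is componentwise. Values of
  \<open>y\<close> outside \<open>\<Omega>\<close> are irrelevant.
\<close>

definition comp_adapt_feasible ::
  "(real ^ 'n) set \<Rightarrow> (real ^ 'n \<Rightarrow> real ^ 'p ^ 'm) \<Rightarrow> (real ^ 'n \<Rightarrow> real ^ 'q ^ 'm)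
    \<Rightarrow> (real ^ 'n \<Rightarrow> real ^ 'm) \<Rightarrow> 'p set \<Rightarrow> 'q set
    \<Rightarrow> ((real ^ 'p) \<times> (real ^ 'n \<Rightarrow> real ^ 'q)) set" where
  "comp_adapt_feasible \<Omega> A B b J K =
    {(x, y). x \<in> mixed_integer J \<and>
       (\<forall>\<omega>\<in>\<Omega>. y \<omega> \<in> mixed_integer K \<and> A \<omega> *v x + B \<omega> *v y \<omega> \<le> b \<omega>)}"

definition comp_adapt_val ::
  "(real ^ 'n) set \<Rightarrow> (real ^ 'n \<Rightarrow> real ^ 'p ^ 'm) \<Rightarrow> (real ^ 'n \<Rightarrow> real ^ 'q ^ 'm)
    \<Rightarrow> (real ^ 'n \<Rightarrow> real ^ 'm) \<Rightarrow> real ^ 'p \<Rightarrow> real ^ 'q \<Rightarrow> 'p set \<Rightarrow> 'q set \<Rightarrow> ereal" where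
  "comp_adapt_val \<Omega> A B b c d J K =
    (INF (x, y) \<in> comp_adapt_feasible \<Omega> A B b J K.
       ereal (c \<bullet> x) + (SUP \<omega>\<in>\<Omega>. ereal (d \<bullet> y \<omega>)))"

text \<open>
  The pieces \<open>W 1, \<dots>, W k\<close> of the cover may overlap and may be empty.
\<close>

definition fin_adapt_feasible ::
  "nat \<Rightarrow> (real ^ 'n) set \<Rightarrow> (real ^ 'n \<Rightarrow> real ^ 'p ^ 'm) \<Rightarrow> (real ^ 'n \<Rightarrow> real ^ 'q ^ 'm)
    \<Rightarrow> (real ^ 'n \<Rightarrow> real ^ 'm) \<Rightarrow> 'p set \<Rightarrow> 'q set
    \<Rightarrow> ((nat \<Rightarrow> (real ^ 'n) set) \<times> (real ^ 'p) \<times> (nat \<Rightarrow> real ^ 'q)) set" where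
  "fin_adapt_feasible k \<Omega> A B b J K =
    {(W, x, y). (\<Union>i\<in>{1..k}. W i) = \<Omega> \<and> x \<in> mixed_integer J \<and>
       (\<forall>i\<in>{1..k}. y i \<in> mixed_integer K \<and> (\<forall>\<omega>\<in>W i. A \<omega> *v x + B \<omega> *v y i \<le> b \<omega>))}"

definition fin_adapt_val ::
  "nat \<Rightarrow> (real ^ 'n) set \<Rightarrow> (real ^ 'n \<Rightarrow> real ^ 'p ^ 'm) \<Rightarrow> (real ^ 'n \<Rightarrow> real ^ 'q ^ 'm)
    \<Rightarrow> (real ^ 'n \<Rightarrow> real ^ 'm) \<Rightarrow> real ^ 'p \<Rightarrow> real ^ 'q \<Rightarrow> 'p set \<Rightarrow> 'q set \<Rightarrow> ereal" where
  "fin_adapt_val k \<Omega> A B b c d J K =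
    (INF (W, x, y) \<in> fin_adapt_feasible k \<Omega> A B b J K.
       ereal (c \<bullet> x) + (SUP i\<in>{1..k}. ereal (d \<bullet> y i)))"

definition modified_continuity ::
  "(real ^ 'n) set \<Rightarrow> (real ^ 'n \<Rightarrow> real ^ 'p ^ 'm) \<Rightarrow> (real ^ 'n \<Rightarrow> real ^ 'q ^ 'm)
    \<Rightarrow> (real ^ 'n \<Rightarrow> real ^ 'm) \<Rightarrow> real ^ 'p \<Rightarrow> real ^ 'q \<Rightarrow> 'p set \<Rightarrow> 'q set \<Rightarrow> bool" where
  "modified_continuity \<Omega> A B b c d J K \<longleftrightarrow>
    (\<forall>\<epsilon>>0. \<exists>x\<in>mixed_integer J. \<forall>\<omega>\<in>\<Omega>. \<exists>\<delta>>0. \<exists>y\<in>mixed_integer K.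
       (\<forall>\<omega>'\<in>\<Omega>. norm (\<omega> - \<omega>') \<le> \<delta> \<longrightarrow> A \<omega>' *v x + B \<omega>' *v y \<le> b \<omega>') \<and>
       ereal (c \<bullet> x + d \<bullet> y - \<epsilon>) \<le> comp_adapt_val \<Omega> A B b c d J K)"

end

theory Submission
  imports Defs
begin

text \<open>
  A finite cover with decisions \<open>y\<^sub>i\<close> induces a recourse function, so every finite adaptability
  value is at least the complete adaptability value. Conversely, the modified continuity assumption
  attaches to each scenario a neighbourhood on which a single \<open>\<epsilon>\<close>-optimal recourse decision is
  feasible, with the same \<open>x\<close> everywhere; by compactness finitely many of these neighbourhoods
  suffice.
\<close>

lemma comp_adapt_val_le_fin_adapt_val:
  "comp_adapt_val \<Omega> A B b c d J K \<le> fin_adapt_val k \<Omega> A B b c d J K"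
  unfolding fin_adapt_val_def
proof (rule INF_greatest, clarify)
  fix W x y
  assume feas: "(W, x, y) \<in> fin_adapt_feasible k \<Omega> A B b J K"
  then have "\<forall>\<omega>\<in>\<Omega>. \<exists>i\<in>{1..k}. \<omega> \<in> W i"
    unfolding fin_adapt_feasible_def by blast
  \<comment> \<open>Pieces may overlap, so \<open>g\<close> selects one index per scenario. The
    recourse \<open>y \<circ> g\<close> takes only values among the \<open>y i\<close>, hence its
    worst cost cannot exceed theirs.\<close>
  then obtain g where g: "\<And>\<omega>. \<omega> \<in> \<Omega> \<Longrightarrow> g \<omega> \<in> {1..k} \<and> \<omega> \<in> W (g \<omega>)"
    by metis
  have "(x, y \<circ> g) \<in> comp_adapt_feasible \<Omega> A B b J K"
    using feas g unfolding fin_adapt_feasible_def comp_adapt_feasible_def by simp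
  then have "comp_adapt_val \<Omega> A B b c d J K
      \<le> ereal (c \<bullet> x) + (SUP \<omega>\<in>\<Omega>. ereal (d \<bullet> (y \<circ> g) \<omega>))"
    unfolding comp_adapt_val_def by (rule INF_lower2) simp
  also have "\<dots> \<le> ereal (c \<bullet> x) + (SUP i\<in>{1..k}. ereal (d \<bullet> y i))"
    using g by (intro add_left_mono SUP_mono) auto
  finally show "comp_adapt_val \<Omega> A B b c d J K
      \<le> ereal (c \<bullet> x) + (SUP i\<in>{1..k}. ereal (d \<bullet> y i))" .
qed

text \<open>Pads a finite subcover to exactly \<open>k\<close> pieces: truncating indices at
  \<open>card T\<close> repeats the last element.\<close>

lemma finite_enumeration_with_repetition:
  assumes "finite T" "T \<noteq> {}" "card T \<le> k"
  obtains f :: "nat \<Rightarrow> 'a" where "f ` {1..k} = T"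
proof -
  obtain h where h: "bij_betw h {1..card T} T"
    using ex_bij_betw_nat_finite_1[OF assms(1)] by blast
  have pos: "1 \<le> card T"
    using assms by (simp add: Suc_le_eq card_gt_0_iff)
  have "(\<lambda>i. min i (card T)) ` {1..k} = {1..card T}"
  proof
    show "(\<lambda>i. min i (card T)) ` {1..k} \<subseteq> {1..card T}"
      using pos by auto
    show "{1..card T} \<subseteq> (\<lambda>i. min i (card T)) ` {1..k}"
    proof
      fix j assume "j \<in> {1..card T}"
      then show "j \<in> (\<lambda>i. min i (card T)) ` {1..k}"
        using assms(3) by (intro image_eqI[of _ _ j]) auto
    qed
  qed
  then have "(\<lambda>i. h (min i (card T))) ` {1..k} = T"
    using h by (metis bij_betw_imp_surj_on image_image)
  then show thesis by (rule that)
qed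

text \<open>The threshold for \<open>k\<close> is the size of a finite subcover. The gluing works
  because \<open>x\<close> is common to all scenarios; only the recourse varies with the
  piece.\<close>

lemma eventually_fin_adapt_val_le:
  fixes \<Omega> :: "(real ^ 'n) set"
  assumes "compact \<Omega>" and "\<Omega> \<noteq> {}"
    and x: "x \<in> mixed_integer J"
    and local_recourse: "\<And>\<omega>. \<omega> \<in> \<Omega> \<Longrightarrow> \<exists>\<delta>>0. \<exists>y\<in>mixed_integer K.
       (\<forall>\<omega>'\<in>\<Omega>. norm (\<omega> - \<omega>') \<le> \<delta> \<longrightarrow> A \<omega>' *v x + B \<omega>' *v y \<le> b \<omega>') \<and> c \<bullet> x + d \<bullet> y \<le> r"
  shows "\<forall>\<^sub>F k in sequentially. fin_adapt_val k \<Omega> A B b c d J K \<le> ereal r"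
proof -
  from local_recourse obtain \<delta> y where
    \<delta>: "\<And>\<omega>. \<omega> \<in> \<Omega> \<Longrightarrow> 0 < \<delta> \<omega>" and
    y: "\<And>\<omega>. \<omega> \<in> \<Omega> \<Longrightarrow> y \<omega> \<in> mixed_integer K" and
    feas: "\<And>\<omega> \<omega>'. \<omega> \<in> \<Omega> \<Longrightarrow> \<omega>' \<in> \<Omega> \<Longrightarrow> norm (\<omega> - \<omega>') \<le> \<delta> \<omega>
      \<Longrightarrow> A \<omega>' *v x + B \<omega>' *v y \<omega> \<le> b \<omega>'" and
    cost: "\<And>\<omega>. \<omega> \<in> \<Omega> \<Longrightarrow> c \<bullet> x + d \<bullet> y \<omega> \<le> r"
    by metis
  \<comment> \<open>Compactness requires open balls; each lies in the closed ball on which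
    \<open>feas\<close> applies.\<close>
  obtain T where T: "T \<subseteq> \<Omega>" "finite T" "\<Omega> \<subseteq> (\<Union>\<omega>\<in>T. ball \<omega> (\<delta> \<omega>))"
    using compactE_image[OF assms(1), of \<Omega> "\<lambda>\<omega>. ball \<omega> (\<delta> \<omega>)"] \<delta> by force
  have "T \<noteq> {}" using T(3) assms(2) by auto
  have "fin_adapt_val k \<Omega> A B b c d J K \<le> ereal r" if k: "card T \<le> k" for k
  proof -
    obtain f where f: "f ` {1..k} = T"
      using finite_enumeration_with_repetition[OF T(2) \<open>T \<noteq> {}\<close> k] by blast
    \<comment> \<open>Intersecting with \<open>\<Omega>\<close> makes the union exactly
      \<open>\<Omega>\<close> and keeps every piece within the scope of \<open>feas\<close>.\<close>
    define W where "W i = \<Omega> \<inter> ball (f i) (\<delta> (f i))" for i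
    have f_in: "f i \<in> \<Omega>" if "i \<in> {1..k}" for i
      using that f T(1) by blast
    have "(\<Union>i\<in>{1..k}. W i) = \<Omega>"
      using T(3) unfolding f[symmetric] W_def by auto
    moreover have "A \<omega> *v x + B \<omega> *v y (f i) \<le> b \<omega>" if "i \<in> {1..k}" "\<omega> \<in> W i" for i \<omega>
      using that by (intro feas f_in) (auto simp: W_def dist_norm)
    ultimately have "(W, x, y \<circ> f) \<in> fin_adapt_feasible k \<Omega> A B b J K"
      using x y f_in unfolding fin_adapt_feasible_def by simp
    then have "fin_adapt_val k \<Omega> A B b c d J K
        \<le> ereal (c \<bullet> x) + (SUP i\<in>{1..k}. ereal (d \<bullet> (y \<circ> f) i))"
      unfolding fin_adapt_val_def by (rule INF_lower2) simp
    also have "\<dots> \<le> ereal (c \<bullet> x) + ereal (r - c \<bullet> x)"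
      using cost f_in by (intro add_left_mono SUP_least) (force simp: algebra_simps)
    finally show ?thesis by simp
  qed
  then show ?thesis
    by (auto intro: eventually_sequentiallyI)
qed

theorem theorem2p1:
  fixes \<Omega> :: "(real ^ 'n) set"
    and A :: "real ^ 'n \<Rightarrow> real ^ 'p ^ 'm"
    and B :: "real ^ 'n \<Rightarrow> real ^ 'q ^ 'm"
    and b :: "real ^ 'n \<Rightarrow> real ^ 'm"
    and c :: "real ^ 'p" and d :: "real ^ 'q"
    and J :: "'p set" and K :: "'q set"
  assumes "compact \<Omega>" and "\<Omega> \<noteq> {}"
    and "affine_on \<Omega> A" and "affine_on \<Omega> B" and "affine_on \<Omega> b"
    and "modified_continuity \<Omega> A B b c d J K"
  shows "(\<lambda>k. fin_adapt_val k \<Omega> A B b c d J K) \<longlonglongrightarrow> comp_adapt_val \<Omega> A B b c d J K"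
proof -
  define V where "V = comp_adapt_val \<Omega> A B b c d J K"
  have lower: "V \<le> fin_adapt_val k \<Omega> A B b c d J K" for k
    unfolding V_def by (rule comp_adapt_val_le_fin_adapt_val)
  \<comment> \<open>Taking \<epsilon> = 1 and any scenario of the non-empty \<open>\<Omega>\<close>,
    the cost condition puts a real number below \<open>V\<close>.\<close>
  have "V \<noteq> -\<infinity>"
  proof -
    have "\<exists>t. ereal t \<le> V"
      using assms(2,6) unfolding modified_continuity_def V_def
      by (meson ex_in_conv zero_less_one)
    then show ?thesis by auto
  qed
  have "(\<lambda>k. fin_adapt_val k \<Omega> A B b c d J K) \<longlonglongrightarrow> V"
  proof (rule order_tendstoI)
    fix a assume "a < V"
    then show "\<forall>\<^sub>F k in sequentially. a < fin_adapt_val k \<Omega> A B b c d J K"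
      using lower by (simp add: less_le_trans)
  next
    fix a assume "V < a"
    \<comment> \<open>A real \<open>r\<close> strictly between leaves room for a non-strict bound by
      \<open>r\<close>, even when \<open>a\<close> is infinite. It also excludes
      \<open>V = \<infinity>\<close>, so \<open>V\<close> is finite here.\<close>
    then obtain r where r: "V < ereal r" "ereal r < a"
      using ereal_dense2 by blast
    with \<open>V \<noteq> -\<infinity>\<close> obtain v where v: "V = ereal v"
      by (cases V) auto
    \<comment> \<open>With \<epsilon> = \<open>r - v\<close>, being \<epsilon>-optimal means exactly
      having cost at most \<open>r\<close>.\<close>
    have "0 < r - v" using r(1) v by simp
    with assms(6) obtain x where x: "x \<in> mixed_integer J" and
      rec: "\<forall>\<omega>\<in>\<Omega>. \<exists>\<delta>>0. \<exists>y\<in>mixed_integer K.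
        (\<forall>\<omega>'\<in>\<Omega>. norm (\<omega> - \<omega>') \<le> \<delta> \<longrightarrow> A \<omega>' *v x + B \<omega>' *v y \<le> b \<omega>') \<and>
        ereal (c \<bullet> x + d \<bullet> y - (r - v)) \<le> V"
      unfolding modified_continuity_def V_def by blast
    have "ereal (t - (r - v)) \<le> V \<longleftrightarrow> t \<le> r" for t
      unfolding v by auto
    then have "\<forall>\<^sub>F k in sequentially. fin_adapt_val k \<Omega> A B b c d J K \<le> ereal r"
      using rec by (intro eventually_fin_adapt_val_le[OF assms(1,2) x]) simp
    then show "\<forall>\<^sub>F k in sequentially. fin_adapt_val k \<Omega> A B b c d J K < a"
      by eventually_elim (use r(2) in simp)
  qed
  then show ?thesis unfolding V_def .
qed

end
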